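(* Let $A$ be an associative algebra, $M$ an $A$-bimodule and $P:M\to A$ a relative averaging operator. For any linear map $P':M\to A$, the sum $P+P'$ is also a relative averaging operator if and only if $P'$ is a Maurer-Cartan element of the differential graded Lie algebra $(CY^\bullet(M,A),d_P,\llbracket\ ,\ \rrbracket)$, where $d_P=\llbracket P,-\rrbracket$; that is, if and only if $d_P(P')+\tfrac12\llbracket P',P'\rrbracket=0$.
   Context: Everything is over a field $\mathbf k$ of characteristic $0$. Trees. $Y_n$ ($n\ge 1$) is the set of planar binary trees with $n$ trivalent vertices, one root and $n+1$ leaves labelled $0,1,\dots,n$ from left to right; $Y_0=\{|\}$. For $y_1\in Y_m,y_2\in Y_n$, the grafting $y_1\vee y_2\in Y_{m+n+1}$ joins the roots of $y_1$ (left) and $y_2$ (right) to a new vertex with a new root. $Y_1=\{|\vee|\}$ and $Y_2=\{y_\dashv,y_\vdash\}$, $y_\dashv=|\vee(|\vee|)$, $y_\vdash=(|\vee|)\vee|$. For $m,n\ge1$, $1\le i\le m$: $R_0^{m;i,n}:Y_{m+n-1}\to Y_m$ deletes the leaves labelled $i,\dots,i+n-2$, and $R_i^{m;i,n}:Y_{m+n-1}\to Y_n$ deletes the leaves labelled $0,\dots,i-2$ and $i+n,\dots,m+n-1$ (labels refer to the original tree). Majumdar-Mukherjee bracket. For vector spaces $D,D'$ put $CY^n(D,D')=\mathrm{Hom}(\mathbf k[Y_n]\otimes D^{\otimes n},D')$. For $f\in CY^m(D,D)$, $g\in CY^n(D,D)$, $m,n\geq 1$, $$(f\circ_i g)(y;a_1,\dots,a_{m+n-1})=f\big(R_0^{m;i,n}(y);a_1,\dots,a_{i-1},g(R_i^{m;i,n}(y);a_i,\dots,a_{i+n-1}),a_{i+n},\dots,a_{m+n-1}\big),$$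 $$[f,g]_{\mathsf{MM}}=\sum_{i=1}^m(-1)^{(i-1)(n-1)}f\circ_i g-(-1)^{(m-1)(n-1)}\sum_{i=1}^n(-1)^{(i-1)(m-1)}g\circ_i f .$$ Relative averaging operator. A linear map $P:M\to A$ with $P(u)\cdot P(v)=P(P(u)\cdot_M v)=P(u\cdot_M P(v))$ for all $u,v\in M$, where $\cdot_M$ denotes both $A$-actions on $M$. A linear map $P:M\to A$ is identified with the element of $CY^1(M,A)$ given by $P(|\vee|;u)=P(u)$. The graded Lie bracket $\llbracket\ ,\ \rrbracket$ on $CY^\bullet(M,A)=\oplus_{n\ge0}CY^n(M,A)$. Let $\Delta\in CY^2(A\oplus M,A\oplus M)$ be $$\Delta(y_\dashv;(a,u),(b,v))=(a\cdot b,u\cdot_M b),\qquad \Delta(y_\vdash;(a,u),(b,v))=(a\cdot b,a\cdot_M v).$$ Regard $CY^n(M,A)\subset CY^n(A\oplus M,A\oplus M)$ ($n\ge1$) by extension by zero. For $f\in CY^m(M,A)$, $g\in CY^n(M,A)$, $m,n\ge1$, set $\llbracket f,g\rrbracket=(-1)^m[[\Delta,f]_{\mathsf{MM}},g]_{\mathsf{MM}}\in CY^{m+n}(M,A)$. For $a,b\in A=CY^0(M,A)$ and $f\in CY^m(M,A)$, $m\ge 1$, set $\llbracket a,b\rrbracket=a\cdot b-b\cdot a$, $$\llbracket f,a\rrbracket(y;u_1,\dots,u_m)=\sum_{i=1}^m f(y;u_1,\dots,u_{i-1},a\cdot_M u_i-u_i\cdot_M a,u_{i+1},\dots,u_m)+f(y;u_1,\dots,u_m)\cdot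 a-a\cdot f(y;u_1,\dots,u_m),$$ and $\llbracket a,f\rrbracket=-\llbracket f,a\rrbracket$. This is a graded Lie algebra (degree $n$ on $CY^n(M,A)$), and a relative averaging operator $P$ satisfies $\llbracket P,P\rrbracket=0$, so $d_P=\llbracket P,-\rrbracket$ is a differential. *)

theory Defs
  imports
    "HOL-Analysis.Product_Vector"
    "HOL-Library.Function_Algebras"
begin

section \<open>Planar binary trees\<close>

datatype tree = Leaf | Graft tree tree

fun vertices :: "tree \<Rightarrow> nat" where
  "vertices Leaf = 0"
| "vertices (Graft l r) = vertices l + vertices r + 1"

definition Y :: "nat \<Rightarrow> tree set" where
  "Y n = {y. vertices y = n}"

definition y_dashv :: tree where
  "y_dashv = Graft Leaf (Graft Leaf Leaf)"

definition y_vdash :: tree where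
  "y_vdash = Graft (Graft Leaf Leaf) Leaf"

text \<open>
  \<open>prune S k y\<close> deletes from \<open>y\<close>, whose leaves carry the labels \<open>k, k + 1, \<dots>\<close> from left to
  right, the leaves with label in \<open>S\<close>; a vertex that loses one of its two branches is
  smoothed out. The value is \<open>None\<close> if no leaf is left.
\<close>

fun prune :: "nat set \<Rightarrow> nat \<Rightarrow> tree \<Rightarrow> tree option" where
  "prune S k Leaf = (if k \<in> S then None else Some Leaf)"
| "prune S k (Graft l r) =
    (case (prune S k l, prune S (k + vertices l + 1) r) of
      (None, z) \<Rightarrow> z
    | (Some l', None) \<Rightarrow> Some l'
    | (Some l', Some r') \<Rightarrow> Some (Graft l' r'))"

definition delete_leaves :: "nat set \<Rightarrow> tree \<Rightarrow> tree" where
  "delete_leaves S y = the (prune S 0 y)"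

text \<open>
  For \<open>1 \<le> i \<le> m\<close>, \<open>n \<ge> 1\<close> and \<open>y \<in> Y (m + n - 1)\<close>. The label ranges
  \<open>i, \<dots>, i + n - 2\<close> and \<open>0, \<dots>, i - 2\<close> are written as half-open intervals because they may be
  empty and subtraction on \<open>nat\<close> truncates.
\<close>

definition R_outer :: "nat \<Rightarrow> nat \<Rightarrow> nat \<Rightarrow> tree \<Rightarrow> tree" where
  "R_outer m i n = delete_leaves {i..<i + n - 1}"

definition R_inner :: "nat \<Rightarrow> nat \<Rightarrow> nat \<Rightarrow> tree \<Rightarrow> tree" where
  "R_inner m i n = delete_leaves ({0..<i - 1} \<union> {i + n..<m + n})"


section \<open>Cochains and the Majumdar--Mukherjee bracket\<close>

text \<open>
  A linear map from \<open>k[Y_n] \<otimes> D^n\<close> (tensor power) to \<open>E\<close> is a family, indexed by \<open>Y_n\<close>, of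
  \<open>n\<close>-linear maps \<open>D^n \<rightarrow> E\<close>. It is represented by a function of a tree and a list of
  arguments, with value 0 on trees and lists of the wrong size, so that cochains are equal iff
  the functions are.
\<close>

type_synonym ('d, 'e) cochain = "tree \<Rightarrow> 'd list \<Rightarrow> 'e"

definition CY ::
  "('k::field \<Rightarrow> 'd::ab_group_add \<Rightarrow> 'd) \<Rightarrow> ('k \<Rightarrow> 'e::ab_group_add \<Rightarrow> 'e) \<Rightarrow> nat
    \<Rightarrow> ('d, 'e) cochain set" where
  "CY sD sE n = {f.
     (\<forall>y xs. y \<notin> Y n \<or> length xs \<noteq> n \<longrightarrow> f y xs = 0) \<and>
     (\<forall>y\<in>Y n. \<forall>xs. length xs = n \<longrightarrow>
        (\<forall>i<n. Vector_Spaces.linear sD sE (\<lambda>x. f y (xs[i := x]))))}"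

definition scale_cochain :: "('k \<Rightarrow> 'e \<Rightarrow> 'e) \<Rightarrow> 'k \<Rightarrow> ('d, 'e) cochain \<Rightarrow> ('d, 'e) cochain" where
  "scale_cochain s c f = (\<lambda>y xs. s c (f y xs))"

definition circ ::
  "nat \<Rightarrow> nat \<Rightarrow> nat \<Rightarrow> ('d, 'd::zero) cochain \<Rightarrow> ('d, 'd) cochain \<Rightarrow> ('d, 'd) cochain" where
  "circ m i n f g = (\<lambda>y xs.
     if y \<in> Y (m + n - 1) \<and> length xs = m + n - 1 then
       f (R_outer m i n y)
         (take (i - 1) xs @ [g (R_inner m i n y) (take n (drop (i - 1) xs))] @ drop (i + n - 1) xs)
     else 0)"

definition MM ::
  "('k::field \<Rightarrow> 'd::ab_group_add \<Rightarrow> 'd) \<Rightarrow> nat \<Rightarrow> nat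
    \<Rightarrow> ('d, 'd) cochain \<Rightarrow> ('d, 'd) cochain \<Rightarrow> ('d, 'd) cochain" where
  "MM s m n f g =
     (\<Sum>i = 1..m. scale_cochain s ((-1) ^ ((i - 1) * (n - 1))) (circ m i n f g))
     - scale_cochain s ((-1) ^ ((m - 1) * (n - 1)))
         (\<Sum>i = 1..n. scale_cochain s ((-1) ^ ((i - 1) * (m - 1))) (circ n i m g f))"


section \<open>Algebras, bimodules and relative averaging operators\<close>

text \<open>Algebras need not have a unit.\<close>

locale associative_algebra = vector_space sA
  for sA :: "'k::field_char_0 \<Rightarrow> 'a::ring \<Rightarrow> 'a" +
  assumes scale_mult_left: "sA c x * y = sA c (x * y)"
    and scale_mult_right: "x * sA c y = sA c (x * y)"

locale algebra_bimodule = associative_algebra sA + M: vector_space sM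
  for sA :: "'k::field_char_0 \<Rightarrow> 'a::ring \<Rightarrow> 'a"
    and sM :: "'k \<Rightarrow> 'm::ab_group_add \<Rightarrow> 'm" +
  fixes lact :: "'a \<Rightarrow> 'm \<Rightarrow> 'm"
    and ract :: "'m \<Rightarrow> 'a \<Rightarrow> 'm"
  assumes linear_lact_alg: "Vector_Spaces.linear sA sM (\<lambda>a. lact a u)"
    and linear_lact_mod: "Vector_Spaces.linear sM sM (\<lambda>u. lact a u)"
    and linear_ract_alg: "Vector_Spaces.linear sA sM (\<lambda>a. ract u a)"
    and linear_ract_mod: "Vector_Spaces.linear sM sM (\<lambda>u. ract u a)"
    and lact_lact: "lact (a * b) u = lact a (lact b u)"
    and lact_ract: "ract (lact a u) b = lact a (ract u b)"
    and ract_ract: "ract u (a * b) = ract (ract u a) b"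

definition relative_averaging_operator ::
  "('k::field \<Rightarrow> 'a::ring \<Rightarrow> 'a) \<Rightarrow> ('k \<Rightarrow> 'm::ab_group_add \<Rightarrow> 'm)
    \<Rightarrow> ('a \<Rightarrow> 'm \<Rightarrow> 'm) \<Rightarrow> ('m \<Rightarrow> 'a \<Rightarrow> 'm) \<Rightarrow> ('m \<Rightarrow> 'a) \<Rightarrow> bool" where
  "relative_averaging_operator sA sM lact ract P \<longleftrightarrow>
     Vector_Spaces.linear sM sA P \<and>
     (\<forall>u v. P u * P v = P (lact (P u) v) \<and> P (lact (P u) v) = P (ract u (P v)))"

definition linear_cochain :: "('m \<Rightarrow> 'a::zero) \<Rightarrow> ('m, 'a) cochain" where
  "linear_cochain P = (\<lambda>y us. if y = Graft Leaf Leaf \<and> length us = 1 then P (us ! 0) else 0)"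


section \<open>The graded bracket on cochains of the bimodule with values in the algebra\<close>

definition Delta ::
  "('a::ring \<Rightarrow> 'm::ab_group_add \<Rightarrow> 'm) \<Rightarrow> ('m \<Rightarrow> 'a \<Rightarrow> 'm) \<Rightarrow> ('a \<times> 'm, 'a \<times> 'm) cochain" where
  "Delta lact ract = (\<lambda>y xs.
     case xs of
       [(a, u), (b, v)] \<Rightarrow>
         if y = y_dashv then (a * b, ract u b)
         else if y = y_vdash then (a * b, lact a v)
         else 0
     | _ \<Rightarrow> 0)"

definition extend_by_zero ::
  "('m, 'a) cochain \<Rightarrow> ('a \<times> 'm::zero, 'a \<times> 'm) cochain" where
  "extend_by_zero f = (\<lambda>y xs. (f y (map snd xs), 0))"

text \<open>A left inverse of \<^const>\<open>extend_by_zero\<close>.\<close>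

definition restrict_cochain ::
  "('a::zero \<times> 'm, 'a \<times> 'm) cochain \<Rightarrow> ('m, 'a) cochain" where
  "restrict_cochain F = (\<lambda>y us. fst (F y (map (\<lambda>u. (0, u)) us)))"

definition algebra_cochain :: "'a::zero \<Rightarrow> ('m, 'a) cochain" where
  "algebra_cochain a = (\<lambda>y us. if y = Leaf \<and> us = [] then a else 0)"

text \<open>The bracket of a cochain of positive degree with an element of the algebra.\<close>

definition bracket_alg ::
  "('a::ring \<Rightarrow> 'm::ab_group_add \<Rightarrow> 'm) \<Rightarrow> ('m \<Rightarrow> 'a \<Rightarrow> 'm)
    \<Rightarrow> ('m, 'a) cochain \<Rightarrow> 'a \<Rightarrow> ('m, 'a) cochain" where
  "bracket_alg lact ract f a = (\<lambda>y us.
     (\<Sum>i<length us. f y (us[i := lact a (us ! i) - ract (us ! i) a]))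
     + f y us * a - a * f y us)"

text \<open>
  \<open>bracket sA sM lact ract m n f g\<close> is the bracket of \<open>f\<close> of degree \<open>m\<close> and \<open>g\<close> of degree \<open>n\<close>.
  Elements \<open>f\<close> of degree 0 are identified with \<open>f Leaf []\<close> in the algebra.
\<close>

definition bracket ::
  "('k::field \<Rightarrow> 'a::ring \<Rightarrow> 'a) \<Rightarrow> ('k \<Rightarrow> 'm::ab_group_add \<Rightarrow> 'm)
    \<Rightarrow> ('a \<Rightarrow> 'm \<Rightarrow> 'm) \<Rightarrow> ('m \<Rightarrow> 'a \<Rightarrow> 'm) \<Rightarrow> nat \<Rightarrow> nat
    \<Rightarrow> ('m, 'a) cochain \<Rightarrow> ('m, 'a) cochain \<Rightarrow> ('m, 'a) cochain" where
  "bracket sA sM lact ract m n f g =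
     (if m = 0 \<and> n = 0 then
        algebra_cochain (f Leaf [] * g Leaf [] - g Leaf [] * f Leaf [])
      else if n = 0 then bracket_alg lact ract f (g Leaf [])
      else if m = 0 then - bracket_alg lact ract g (f Leaf [])
      else
        let s = module_prod.scale sA sM in
        scale_cochain sA ((-1) ^ m)
          (restrict_cochain
            (MM s (m + 1) n
              (MM s 2 m (Delta lact ract) (extend_by_zero f))
              (extend_by_zero g))))"

definition twisted_differential ::
  "('k::field \<Rightarrow> 'a::ring \<Rightarrow> 'a) \<Rightarrow> ('k \<Rightarrow> 'm::ab_group_add \<Rightarrow> 'm)
    \<Rightarrow> ('a \<Rightarrow> 'm \<Rightarrow> 'm) \<Rightarrow> ('m \<Rightarrow> 'a \<Rightarrow> 'm) \<Rightarrow> ('m \<Rightarrow> 'a)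
    \<Rightarrow> nat \<Rightarrow> ('m, 'a) cochain \<Rightarrow> ('m, 'a) cochain" where
  "twisted_differential sA sM lact ract P n f =
     bracket sA sM lact ract 1 n (linear_cochain P) f"


section \<open>Maurer--Cartan elements\<close>

text \<open>
  \<open>L n\<close> is the homogeneous component of degree \<open>n\<close> of a differential graded Lie algebra,
  \<open>d n\<close> the differential on it and \<open>br m n\<close> the bracket of degree \<open>m\<close> with degree \<open>n\<close>.
\<close>

definition maurer_cartan ::
  "(nat \<Rightarrow> 'v::ab_group_add set) \<Rightarrow> ('k::field \<Rightarrow> 'v \<Rightarrow> 'v) \<Rightarrow> (nat \<Rightarrow> 'v \<Rightarrow> 'v)
    \<Rightarrow> (nat \<Rightarrow> nat \<Rightarrow> 'v \<Rightarrow> 'v \<Rightarrow> 'v) \<Rightarrow> 'v \<Rightarrow> bool" where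
  "maurer_cartan L s d br x \<longleftrightarrow> x \<in> L 1 \<and> d 1 x + s (1 / 2) (br 1 1 x x) = 0"

end

theory Submission
  imports Defs
begin

text \<open>
  Evaluated on the two trees of \<open>Y 2\<close>, the bracket of linear maps is the polarization of the
  averaging identity, up to sign: \<open>\<lbrakk>P, Q\<rbrakk>\<close> is \<open>P (u \<cdot> Q v) + Q (u \<cdot> P v) - P u \<cdot> Q v - Q u \<cdot> P v\<close>
  on \<open>y_dashv\<close>, and the same with the left action on \<open>y_vdash\<close>. So the averaging defect of \<open>P + P'\<close>
  is that of \<open>P\<close>, which vanishes, plus \<open>\<lbrakk>P, P'\<rbrakk> + 1/2 \<lbrakk>P', P'\<rbrakk>\<close>.
\<close>

lemma vertices_eq_0_iff: "vertices y = 0 \<longleftrightarrow> y = Leaf"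
  by (cases y) auto

lemma vertices_eq_1_iff: "vertices y = Suc 0 \<longleftrightarrow> y = Graft Leaf Leaf"
  by (cases y) (auto simp: vertices_eq_0_iff)

lemma Y_1: "Y 1 = {Graft Leaf Leaf}"
  by (auto simp: Y_def vertices_eq_1_iff)

lemma Y_2: "Y 2 = {y_dashv, y_vdash}"
proof -
  have "vertices y = 2 \<longleftrightarrow> y = y_dashv \<or> y = y_vdash" for y
  proof (cases y)
    case (Graft l r)
    have "vertices l + vertices r = Suc 0 \<longleftrightarrow>
        vertices l = 0 \<and> vertices r = Suc 0 \<or> vertices l = Suc 0 \<and> vertices r = 0"
      by arith
    then show ?thesis
      using Graft
      by (auto simp: vertices_eq_0_iff vertices_eq_1_iff y_dashv_def y_vdash_def)
  qed (auto simp: y_dashv_def y_vdash_def)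
  then show ?thesis
    by (auto simp: Y_def)
qed

text \<open>In degrees 2 and 1 every sign exponent is 0, so only scaling by 1 occurs.
  \<open>R_outer 2 i 1\<close> and \<open>R_inner 1 1 2\<close> delete no leaf, while
  \<open>R_inner 2 i 1\<close> and \<open>R_outer 1 1 2\<close> keep two of three leaves, which
  gives \<open>Graft Leaf Leaf\<close>. \<open>F\<close> is arbitrary since it stands first for
  \<open>Delta\<close>, then for the bracket of \<open>Delta\<close> with a linear map.\<close>

lemma MM_linear_cochain:
  fixes F :: "('a::ring \<times> 'm::ab_group_add, 'a \<times> 'm) cochain"
  assumes s: "\<And>x. s 1 x = x"
  shows "MM s 2 1 F (extend_by_zero (linear_cochain Q)) y xs =
    (if y \<in> Y 2 \<and> length xs = 2 then
       F y [(Q (snd (xs ! 0)), 0), xs ! 1] + F y [xs ! 0, (Q (snd (xs ! 1)), 0)]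
         - (Q (snd (F y xs)), 0)
     else 0)"
proof (cases "y \<in> Y 2 \<and> length xs = 2")
  case True
  then obtain x1 x2 where xs: "xs = [x1, x2]"
    by (auto simp: numeral_2_eq_2 length_Suc_conv)
  from True have "y = y_dashv \<or> y = y_vdash"
    by (simp add: Y_2)
  then show ?thesis
    using True
    by (auto simp: xs MM_def s scale_cochain_def circ_def extend_by_zero_def linear_cochain_def
        R_outer_def R_inner_def delete_leaves_def y_dashv_def y_vdash_def numeral_2_eq_2)
next
  case False
  then show ?thesis
    by (auto simp: MM_def s scale_cochain_def circ_def numeral_2_eq_2)
qed

context algebra_bimodule
begin

text \<open>Restricted arguments \<open>(0, u)\<close> and extended values \<open>(Q u, 0)\<close>
  feed zeros into the actions.\<close>

lemmas action_zero =
  linear_lact_alg[THEN Vector_Spaces.linear.axioms(3), THEN module_hom.zero]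
  linear_lact_mod[THEN Vector_Spaces.linear.axioms(3), THEN module_hom.zero]
  linear_ract_alg[THEN Vector_Spaces.linear.axioms(3), THEN module_hom.zero]
  linear_ract_mod[THEN Vector_Spaces.linear.axioms(3), THEN module_hom.zero]

text \<open>Additivity is taken in the algebra slot, where \<open>P u + P' u\<close> enters.\<close>

lemmas action_add =
  linear_lact_alg[THEN Vector_Spaces.linear.axioms(3), THEN module_hom.add]
  linear_ract_alg[THEN Vector_Spaces.linear.axioms(3), THEN module_hom.add]

end

text \<open>Two uses of \<open>MM_linear_cochain\<close>. On \<open>(0, u)\<close>,
  \<open>(0, v)\<close> a product survives only where \<open>P\<close> and \<open>Q\<close> hit
  different arguments, an action term only where one map acts inside and the other outside. The
  factor \<open>(-1) ^ m\<close> with \<open>m = 1\<close> reverses all signs.\<close>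

lemma bracket_linear_cochain:
  assumes "algebra_bimodule sA sM lact ract"
    and P: "Vector_Spaces.linear sM sA P" and Q: "Vector_Spaces.linear sM sA Q"
  shows "bracket sA sM lact ract 1 1 (linear_cochain P) (linear_cochain Q) y us =
    (if length us = 2 then
       if y = y_dashv then
         P (ract (us ! 0) (Q (us ! 1))) + Q (ract (us ! 0) (P (us ! 1)))
           - P (us ! 0) * Q (us ! 1) - Q (us ! 0) * P (us ! 1)
       else if y = y_vdash then
         P (lact (Q (us ! 0)) (us ! 1)) + Q (lact (P (us ! 0)) (us ! 1))
           - P (us ! 0) * Q (us ! 1) - Q (us ! 0) * P (us ! 1)
       else 0
     else 0)"
proof -
  interpret algebra_bimodule sA sM lact ract by fact
  interpret P: Vector_Spaces.linear sM sA P by fact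
  interpret Q: Vector_Spaces.linear sM sA Q by fact
  interpret prod: module_prod sA sM ..
  have s: "prod.scale 1 x = x" for x
    by simp
  have scale_m1: "sA (- 1) x = - x" for x
    by simp
  show ?thesis
  proof (cases "length us = 2")
    case True
    then obtain u v where us: "us = [u, v]"
      by (auto simp: numeral_2_eq_2 length_Suc_conv)
    show ?thesis
      by (auto simp: us bracket_def Let_def MM_linear_cochain[where s = prod.scale, OF s]
          scale_cochain_def restrict_cochain_def Delta_def Y_2 action_zero scale_m1
          y_dashv_def y_vdash_def simp del: One_nat_def)
  next
    case False
    then show ?thesis
      by (simp add: bracket_def Let_def MM_linear_cochain[where s = prod.scale, OF s]
          scale_cochain_def restrict_cochain_def del: One_nat_def)
  qed
qed

text \<open>Reduces \<open>maurer_cartan\<close> to its equation.\<close>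

lemma linear_cochain_in_CY:
  assumes "Vector_Spaces.linear sM sA P"
  shows "linear_cochain P \<in> CY sM sA 1"
proof -
  have "(\<lambda>x. P (us[i := x] ! 0)) = P" if "length us = 1" "i < 1" for us i
    using that by auto
  then show ?thesis
    using assms by (simp add: CY_def linear_cochain_def Y_1 del: One_nat_def)
qed

theorem theorem4p2:
  fixes sA :: "'k::field_char_0 \<Rightarrow> 'a::ring \<Rightarrow> 'a"
    and sM :: "'k \<Rightarrow> 'm::ab_group_add \<Rightarrow> 'm"
    and lact :: "'a \<Rightarrow> 'm \<Rightarrow> 'm"
    and ract :: "'m \<Rightarrow> 'a \<Rightarrow> 'm"
    and P P' :: "'m \<Rightarrow> 'a"
  assumes "algebra_bimodule sA sM lact ract"
    and "relative_averaging_operator sA sM lact ract P"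
    and "Vector_Spaces.linear sM sA P'"
  shows "(relative_averaging_operator sA sM lact ract (\<lambda>u. P u + P' u) \<longleftrightarrow>
            maurer_cartan (CY sM sA) (scale_cochain sA)
              (twisted_differential sA sM lact ract P)
              (bracket sA sM lact ract) (linear_cochain P'))
       \<and> (maurer_cartan (CY sM sA) (scale_cochain sA)
              (twisted_differential sA sM lact ract P)
              (bracket sA sM lact ract) (linear_cochain P') \<longleftrightarrow>
            twisted_differential sA sM lact ract P 1 (linear_cochain P')
              + scale_cochain sA (1 / 2)
                  (bracket sA sM lact ract 1 1 (linear_cochain P') (linear_cochain P')) = 0)"
proof -
  interpret algebra_bimodule sA sM lact ract by fact
  have P: "Vector_Spaces.linear sM sA P"
    and P_mult: "P (lact (P u) v) = P u * P v" "P (ract u (P v)) = P u * P v" for u v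
    using assms(2) by (auto simp: relative_averaging_operator_def)
  note P' = assms(3)
  interpret P: Vector_Spaces.linear sM sA P by fact
  interpret P': Vector_Spaces.linear sM sA P' by fact
  let ?B = "bracket sA sM lact ract 1 1"
  \<comment> \<open>At equal arguments the polarization doubles every term; halving undoes this in
    characteristic 0.\<close>
  have half: "sA (1 / 2) (x + x) = x" for x
  proof -
    have "sA (1 / 2) (x + x) = sA (1 / 2 + 1 / 2) x"
      by (simp only: scale_left_distrib scale_right_distrib)
    then show ?thesis
      by simp
  qed
  have half_B: "sA (1 / 2) (?B (linear_cochain P') (linear_cochain P') y us) =
      (if length us = 2 then
         if y = y_dashv then P' (ract (us ! 0) (P' (us ! 1))) - P' (us ! 0) * P' (us ! 1)
         else if y = y_vdash then P' (lact (P' (us ! 0)) (us ! 1)) - P' (us ! 0) * P' (us ! 1)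
         else 0
       else 0)" for y us
  proof -
    have "a + a - b - b = (a - b) + (a - b)" for a b :: 'a
      by simp
    then show ?thesis
      unfolding bracket_linear_cochain[OF assms(1) P' P']
      by (simp only: half scale_zero_right split: if_split) simp
  qed
  \<comment> \<open>The right side avoids subtraction, to agree verbatim with that of
    \<open>avg_iff\<close>.\<close>
  have mc_iff: "?B (linear_cochain P) (linear_cochain P')
        + scale_cochain sA (1 / 2) (?B (linear_cochain P') (linear_cochain P')) = 0 \<longleftrightarrow>
      (\<forall>u v. P (ract u (P' v)) + P' (ract u (P v)) + P' (ract u (P' v))
            = P u * P' v + P' u * P v + P' u * P' v \<and>
          P (lact (P' u) v) + P' (lact (P u) v) + P' (lact (P' u) v)
            = P u * P' v + P' u * P v + P' u * P' v)" (is "?C = 0 \<longleftrightarrow> ?R")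
  proof
    assume C: "?C = 0"
    \<comment> \<open>These values determine \<open>?C\<close>: elsewhere both brackets
      vanish.\<close>
    have "?C y_dashv [u, v] = 0" "?C y_vdash [u, v] = 0" for u v
      by (simp_all only: C zero_fun_def)
    then show ?R
      by (simp add: scale_cochain_def half_B bracket_linear_cochain[OF assms(1) P P']
          y_dashv_def y_vdash_def algebra_simps del: One_nat_def)
  next
    assume ?R
    then show "?C = 0"
      by (auto simp: fun_eq_iff scale_cochain_def half_B bracket_linear_cochain[OF assms(1) P P']
          algebra_simps simp del: One_nat_def)
  qed
  have "Vector_Spaces.linear sM sA (\<lambda>u. P u + P' u)"
    using P P'
    by (simp add: vector_space_pair.linear_compose_add vector_space_pair_def
        M.vector_space_axioms vector_space_axioms)
  \<comment> \<open>After expansion \<open>P_mult\<close> turns each pure \<open>P\<close> term into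
    \<open>P u * P v\<close>, which cancels. The chain of equalities then becomes two equalities
    with the same product.\<close>
  then have avg_iff: "relative_averaging_operator sA sM lact ract (\<lambda>u. P u + P' u) \<longleftrightarrow>
      (\<forall>u v. P (ract u (P' v)) + P' (ract u (P v)) + P' (ract u (P' v))
            = P u * P' v + P' u * P v + P' u * P' v \<and>
          P (lact (P' u) v) + P' (lact (P u) v) + P' (lact (P' u) v)
            = P u * P' v + P' u * P v + P' u * P' v)"
    unfolding relative_averaging_operator_def
    by (simp add: action_add P.add P'.add P_mult distrib_left distrib_right add_ac)
      metis
  show ?thesis
    using linear_cochain_in_CY[OF P']
    by (simp add: maurer_cartan_def twisted_differential_def mc_iff avg_iff del: One_nat_def)
qed

end
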